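(* Let $t$ be a non-negative integer and $\ell$ a positive integer, let $H$ be a $t$-tree, let $P$ be a path, let $K_\ell$ be a complete graph on $\ell$ vertices, and let $G$ be a subgraph of the strong product $H\boxtimes P\boxtimes K_\ell$. Then $G$ has an odd colouring using at most $8\ell t+5\ell-1$ colours.
   Context: All graphs are finite and simple. A $t$-tree is a graph that is either a clique on $t+1$ vertices, or a graph $H$ containing a vertex $v$ of degree $t$ whose neighbours form a clique and such that $H-\{v\}$ is a $t$-tree. For graphs $A$ and $B$, the strong product $A\boxtimes B$ has vertex set $V(A)\times V(B)$, and $(x_1,y_1)(x_2,y_2)$ is an edge iff (i) $x_1x_2\in E(A)$ and $y_1=y_2$, or (ii) $x_1=x_2$ and $y_1y_2\in E(B)$, or (iii) $x_1x_2\in E(A)$ and $y_1y_2\in E(B)$; the triple product is $(H\boxtimes P)\boxtimes K_\ell$. A vertex colouring $\varphi:V(G)\to\mathbb{N}$ (not necessarily proper) is odd if for every vertex $v$ with $|N_G(v)|>0$ there is a colour $\alpha$ such that $|\{w\in N_G(v):\varphi(w)=\alpha\}|$ is odd. A colouring uses $c$ colours if $|\{\varphi(v):v\in V(G)\}|=c$. *)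

theory Defs
  imports "Graph_Theory.Graph_Theory"
begin

text \<open>
  A finite simple graph is a \<^locale>\<open>pair_graph\<close>: a finite symmetric loop-free digraph, in which an
  edge \<open>uv\<close> is represented by the two arcs \<open>(u, v)\<close> and \<open>(v, u)\<close>.
\<close>

definition neighbours :: "'a pair_pre_digraph \<Rightarrow> 'a \<Rightarrow> 'a set" where
  "neighbours G v = {w. (v, w) \<in> parcs G}"

definition clique_in :: "'a pair_pre_digraph \<Rightarrow> 'a set \<Rightarrow> bool" where
  "clique_in G S \<longleftrightarrow> S \<subseteq> pverts G \<and> (\<forall>x\<in>S. \<forall>y\<in>S. x \<noteq> y \<longrightarrow> (x, y) \<in> parcs G)"

definition remove_vertex :: "'a pair_pre_digraph \<Rightarrow> 'a \<Rightarrow> 'a pair_pre_digraph" where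
  "remove_vertex G v =
     \<lparr>pverts = pverts G - {v}, parcs = {(x, y) \<in> parcs G. x \<noteq> v \<and> y \<noteq> v}\<rparr>"

lemma with_proj_remove_vertex:
  "with_proj (remove_vertex G v) = pre_digraph.del_vert (with_proj G) v"
  by (auto simp: remove_vertex_def with_proj_def pre_digraph.del_vert_def)

inductive t_tree :: "nat \<Rightarrow> 'a pair_pre_digraph \<Rightarrow> bool" for t :: nat where
  clique: "complete_digraph (t + 1) (with_proj H) \<Longrightarrow> t_tree t H"
| add_vertex: "pair_graph H \<Longrightarrow> v \<in> pverts H \<Longrightarrow> card (neighbours H v) = t \<Longrightarrow>
    clique_in H (neighbours H v) \<Longrightarrow> t_tree t (remove_vertex H v) \<Longrightarrow> t_tree t H"

definition path_graph :: "'a pair_pre_digraph \<Rightarrow> bool" where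
  "path_graph P \<longleftrightarrow> (\<exists>xs. xs \<noteq> [] \<and> distinct xs \<and> pverts P = set xs \<and>
     parcs P = (\<Union>i\<in>{i. Suc i < length xs}. {(xs ! i, xs ! Suc i), (xs ! Suc i, xs ! i)}))"

definition strong_product ::
    "'a pair_pre_digraph \<Rightarrow> 'b pair_pre_digraph \<Rightarrow> ('a \<times> 'b) pair_pre_digraph" (infixl \<open>\<boxtimes>\<close> 70) where
  "A \<boxtimes> B = \<lparr>pverts = pverts A \<times> pverts B,
     parcs = {((x1, y1), (x2, y2)). {x1, x2} \<subseteq> pverts A \<and> {y1, y2} \<subseteq> pverts B \<and>
       ((x1, x2) \<in> parcs A \<and> y1 = y2 \<or>
        x1 = x2 \<and> (y1, y2) \<in> parcs B \<or>
        (x1, x2) \<in> parcs A \<and> (y1, y2) \<in> parcs B)}\<rparr>"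

definition odd_colouring :: "'a pair_pre_digraph \<Rightarrow> ('a \<Rightarrow> nat) \<Rightarrow> bool" where
  "odd_colouring G \<phi> \<longleftrightarrow> (\<forall>v\<in>pverts G. card (neighbours G v) > 0 \<longrightarrow>
     (\<exists>\<alpha>. odd (card {w \<in> neighbours G v. \<phi> w = \<alpha>})))"

definition num_colours :: "'a pair_pre_digraph \<Rightarrow> ('a \<Rightarrow> nat) \<Rightarrow> nat" where
  "num_colours G \<phi> = card (\<phi> ` pverts G)"

lemma pair_graph_t_tree: "t_tree t H \<Longrightarrow> pair_graph H"
  by (induction rule: t_tree.induct) (auto intro: pair_graphI_complete)

lemma pair_graph_path_graph:
  assumes "path_graph P"
  shows "pair_graph P"
proof -
  obtain xs where xs: "distinct xs" "pverts P = set xs"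
    "parcs P = (\<Union>i\<in>{i. Suc i < length xs}. {(xs ! i, xs ! Suc i), (xs ! Suc i, xs ! i)})"
    using assms by (auto simp: path_graph_def)
  have "finite {i. Suc i < length xs}"
    by (rule finite_subset[of _ "{..<length xs}"]) auto
  then have "finite (parcs P)"
    by (simp add: xs)
  with xs show ?thesis
    by unfold_locales (auto simp: symmetric_def sym_def nth_eq_iff_index_eq)
qed

lemma pair_graph_strong_product:
  assumes "pair_graph A" and "pair_graph B"
  shows "pair_graph (A \<boxtimes> B)"
proof -
  interpret A: pair_graph A by fact
  interpret B: pair_graph B by fact
  have "parcs (A \<boxtimes> B) \<subseteq> (pverts A \<times> pverts B) \<times> (pverts A \<times> pverts B)"
    by (auto simp: strong_product_def)
  then have "finite (parcs (A \<boxtimes> B))"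
    by (rule finite_subset) (simp add: A.pair_finite_verts B.pair_finite_verts)
  then show ?thesis
    by unfold_locales
      (auto simp: strong_product_def symmetric_def sym_def
        A.pair_finite_verts B.pair_finite_verts
        dest: A.arcs_symmetric B.arcs_symmetric A.no_loops' B.no_loops')
qed

end

theory Submission
  imports Defs "HOL-Library.Product_Lexorder"
begin

text \<open>
  Order the vertices of \<open>G\<close> and let \<open>m w\<close> be the least neighbour of a non-isolated vertex \<open>w\<close>. If
  every vertex \<open>u\<close> avoids the colours of all \<open>m w < u\<close> with \<open>w\<close> a neighbour of \<open>u\<close>, then the colour
  of \<open>m w\<close> occurs exactly once around \<open>w\<close>. Colouring greedily, \<open>u\<close> has to avoid one colour for
  each neighbour \<open>w < u\<close>, and the colours of those \<open>v < u\<close> that share a neighbour \<open>w > u\<close> with \<open>u\<close>.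
  Order \<open>H \<boxtimes> P \<boxtimes> K\<close> lexicographically, with \<open>H\<close> in the order in which the \<open>t\<close>-tree is built and
  \<open>P\<close> from one end to the other. The first kind contributes at most \<open>3lt + (2l - 1)\<close> colours: one of
  \<open>t\<close> earlier neighbours in \<open>H\<close> and three positions in \<open>P\<close>, or the same vertex of \<open>H\<close> and two
  positions. In the second kind the \<open>H\<close>-coordinates of \<open>u\<close> and \<open>v\<close> lie in a common clique and their
  positions in \<open>P\<close> differ by at most two, which gives at most \<open>5lt + (3l - 1)\<close> colours.
\<close>

section \<open>Greedy colourings along a vertex ordering\<close>

lemma greedy_colouring:
  fixes r :: "'v \<Rightarrow> 'o::linorder" and F :: "'v \<Rightarrow> 'v set"
  assumes "finite V"
    and "\<And>u. u \<in> V \<Longrightarrow> F u \<subseteq> {v \<in> V. r v < r u}"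
    and "\<And>u. u \<in> V \<Longrightarrow> card (F u) \<le> m"
  shows "\<exists>\<phi>. \<phi> ` V \<subseteq> {..m} \<and> (\<forall>u\<in>V. \<forall>v\<in>F u. \<phi> u \<noteq> \<phi> v)"
  using assms
proof (induction V rule: finite_ranking_induct[where f = r])
  case empty
  then show ?case by simp
next
  case (insert u S)
  \<comment> \<open>\<open>u\<close> has the greatest rank, while \<open>F x\<close> lies strictly
    below \<open>x\<close>, so \<open>u\<close> is in no set \<open>F x\<close>.\<close>
  have F: "F x \<subseteq> {v \<in> S. r v < r x}" if "x \<in> insert u S" for x
    using insert.prems(1)[OF that] insert.hyps(2) that by fastforce
  then obtain \<phi> where \<phi>: "\<phi> ` S \<subseteq> {..m}" "\<forall>x\<in>S. \<forall>v\<in>F x. \<phi> x \<noteq> \<phi> v"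
    using insert.IH insert.prems(2) by auto
  have fin: "finite (F u)"
    using F[of u] insert.hyps(1) by (auto intro: finite_subset)
  \<comment> \<open>There are m + 1 colours in \<open>{..m}\<close> and at most m are forbidden, so
    one is free.\<close>
  have "card (\<phi> ` F u) < card {..m}"
    using insert.prems(2)[of u] card_image_le[OF fin, of \<phi>] by simp
  then obtain c where c: "c \<le> m" "c \<notin> \<phi> ` F u"
    using card_mono[of "\<phi> ` F u" "{..m}"] fin by force
  show ?case
  \<comment> \<open>The ranking induction does not guarantee that \<open>u\<close> is new. If it is,
    colouring it last disturbs no earlier constraint.\<close>
  proof (cases "u \<in> S")
    case True
    then show ?thesis using \<phi> by (auto simp: insert_absorb)
  next
    case False
    then have "u \<notin> F x" if "x \<in> insert u S" for x
      using F[OF that] by auto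
    then show ?thesis
      using \<phi> c False by (intro exI[of _ "\<phi>(u := c)"]) auto
  qed
qed

text \<open>The bounds \<open>a\<close> and \<open>b\<close> split the forbidden vertices
  \<open>m w\<close> of \<open>u\<close> by whether the neighbour \<open>w\<close> comes before or
  after \<open>u\<close>; the final 1 is the spare colour of the greedy step.\<close>

lemma odd_colouring_by_ordering:
  fixes r :: "'v \<Rightarrow> 'o::linorder"
  assumes "pair_graph G" and inj: "inj_on r (pverts G)"
    and a: "\<And>u. u \<in> pverts G \<Longrightarrow> card {w \<in> neighbours G u. r w < r u} \<le> a"
    and b: "\<And>u. u \<in> pverts G \<Longrightarrow>
      card {v. r v < r u \<and> (\<exists>w. u \<in> neighbours G w \<and> v \<in> neighbours G w \<and> r u < r w)} \<le> b"
  shows "\<exists>\<phi>. odd_colouring G \<phi> \<and> num_colours G \<phi> \<le> a + b + 1"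
proof -
  interpret G: pair_graph G by fact
  have nb: "neighbours G v \<subseteq> pverts G" for v
    by (auto simp: neighbours_def dest: G.in_arcsD2)
  then have fin_nb: "finite (neighbours G v)" for v
    using G.pair_finite_verts finite_subset by blast
  have sym: "w \<in> neighbours G v \<longleftrightarrow> v \<in> neighbours G w" for v w
    by (auto simp: neighbours_def dest: G.arcs_symmetric)
  define m where "m w = arg_min_on r (neighbours G w)" for w
  have m_in: "m w \<in> neighbours G w" and m_le: "v \<in> neighbours G w \<Longrightarrow> r (m w) \<le> r v"
    if "neighbours G w \<noteq> {}" for v w
    unfolding m_def using arg_min_if_finite[OF fin_nb that, of r] by (auto simp: not_less[symmetric])
  define F where "F u = {m w |w. w \<in> neighbours G u \<and> r (m w) < r u}" for u
  have card_F: "card (F u) \<le> a + b" if u: "u \<in> pverts G" for u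
  proof -
    let ?A = "{w \<in> neighbours G u. r w < r u}"
    let ?B = "{v. r v < r u \<and> (\<exists>w. u \<in> neighbours G w \<and> v \<in> neighbours G w \<and> r u < r w)}"
    \<comment> \<open>If \<open>w\<close> precedes \<open>u\<close>, then \<open>m w\<close> is
      charged to \<open>w\<close>; otherwise \<open>m w\<close> itself is a vertex below
      \<open>u\<close> sharing the later neighbour \<open>w\<close>.\<close>
    have "F u \<subseteq> m ` ?A \<union> ?B"
    proof
      fix v assume "v \<in> F u"
      then obtain w where w: "v = m w" "w \<in> neighbours G u" "r (m w) < r u"
        by (auto simp: F_def)
      have "w \<noteq> u"
        using w(2) by (auto simp: neighbours_def dest: G.no_loops')
      then have "r w \<noteq> r u"
        using inj u nb w(2) by (auto dest: inj_onD)
      moreover have "u \<in> neighbours G w"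
        using w(2) sym by simp
      moreover from this have "v \<in> neighbours G w"
        using m_in[of w] w(1) by auto
      ultimately show "v \<in> m ` ?A \<union> ?B"
        using w by (cases "r w < r u") auto
    qed
    moreover have "finite ?A" "finite ?B"
      using fin_nb nb by (auto intro: finite_subset[OF _ G.pair_finite_verts])
    ultimately have "card (F u) \<le> card (m ` ?A) + card ?B"
      by (meson card_Un_le card_mono finite_UnI finite_imageI le_trans)
    also have "\<dots> \<le> a + b"
      using card_image_le[OF \<open>finite ?A\<close>, of m] a[OF u] b[OF u] by linarith
    finally show ?thesis .
  qed
  have "F u \<subseteq> {v \<in> pverts G. r v < r u}" for u
    using m_in nb sym by (fastforce simp: F_def)
  then obtain \<phi> where \<phi>: "\<phi> ` pverts G \<subseteq> {..a + b}" "\<forall>u\<in>pverts G. \<forall>v\<in>F u. \<phi> u \<noteq> \<phi> v"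
    using greedy_colouring[of "pverts G" F r "a + b"] card_F by auto
  have "odd (card {v \<in> neighbours G w. \<phi> v = \<phi> (m w)})" if "card (neighbours G w) > 0" for w
  proof -
    have ne: "neighbours G w \<noteq> {}"
      using that by auto
    \<comment> \<open>Any other neighbour \<open>v\<close> of \<open>w\<close> lies above
      \<open>m w\<close>, so \<open>m w\<close> belongs to \<open>F v\<close> and the two colours
      differ.\<close>
    have "v = m w" if v: "v \<in> neighbours G w" "\<phi> v = \<phi> (m w)" for v
    proof (rule ccontr)
      assume "v \<noteq> m w"
      then have "r (m w) \<noteq> r v"
        using inj_onD[OF inj, of "m w" v] m_in[OF ne] nb v(1) by blast
      then have "r (m w) < r v"
        using m_le[OF ne v(1)] by simp
      then have "m w \<in> F v"
        using v(1) sym by (auto simp: F_def)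
      then show False
        using \<phi>(2) v nb by (metis subsetD)
    qed
    then have "{v \<in> neighbours G w. \<phi> v = \<phi> (m w)} = {m w}"
      using m_in[OF ne] by auto
    then show ?thesis by simp
  qed
  moreover have "num_colours G \<phi> \<le> a + b + 1"
    unfolding num_colours_def using card_mono[OF _ \<phi>(1)] by simp
  ultimately show ?thesis
    unfolding odd_colouring_def by blast
qed

section \<open>Orderings of t-trees and paths\<close>

definition earlier :: "('a \<Rightarrow> nat) \<Rightarrow> 'a pair_pre_digraph \<Rightarrow> 'a \<Rightarrow> 'a set" where
  "earlier f H x = {y \<in> neighbours H x. f y < f x}"

text \<open>Any order serves the initial clique. Each added vertex goes last, so its earlier
  neighbours are all its neighbours, a clique of size t, and no other set of earlier neighbours
  changes.\<close>

lemma t_tree_elimination_ordering: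
  assumes "t_tree t H"
  shows "\<exists>f :: 'a \<Rightarrow> nat. inj_on f (pverts H) \<and>
    (\<forall>x\<in>pverts H. card (earlier f H x) \<le> t \<and> clique_in H (earlier f H x))"
  using assms
proof (induction rule: t_tree.induct)
  case (clique H)
  interpret H: pair_graph H
    using clique by (rule pair_graphI_complete)
  have card: "card (pverts H) = t + 1"
    and arcs: "parcs H = {(u, v). u \<in> pverts H \<and> v \<in> pverts H \<and> u \<noteq> v}"
    using clique by (auto simp: complete_digraph_pair_def)
  obtain f :: "'a \<Rightarrow> nat" where f: "inj_on f (pverts H)"
    using finite_imp_inj_to_nat_seg[OF H.pair_finite_verts] by blast
  have "card (earlier f H x) \<le> t" if "x \<in> pverts H" for x
  proof -
    have "earlier f H x \<subseteq> pverts H - {x}"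
      by (auto simp: earlier_def neighbours_def arcs)
    then have "card (earlier f H x) \<le> card (pverts H - {x})"
      by (simp add: card_mono)
    then show ?thesis
      using card that by simp
  qed
  moreover have "clique_in H (earlier f H x)" for x
    by (auto simp: clique_in_def earlier_def neighbours_def arcs)
  ultimately show ?case
    using f by blast
next
  case (add_vertex H v)
  interpret H: pair_graph H by fact
  let ?H = "remove_vertex H v"
  obtain f :: "'a \<Rightarrow> nat" where f: "inj_on f (pverts ?H)"
    and f': "\<forall>x\<in>pverts ?H. card (earlier f ?H x) \<le> t \<and> clique_in ?H (earlier f ?H x)"
    using add_vertex.IH by blast
  define g where "g = f(v := Suc (Max (f ` pverts H)))"
  have less: "g x < g v" if "x \<in> pverts H" "x \<noteq> v" for x
    using that by (auto simp: g_def le_imp_less_Suc)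
  have "inj_on g (pverts H)"
  proof (rule inj_onI)
    fix x y assume "x \<in> pverts H" "y \<in> pverts H" "g x = g y"
    then show "x = y"
      using less[of x] less[of y] inj_onD[OF f, of x y]
      by (cases "x = v"; cases "y = v") (auto simp: g_def remove_vertex_def)
  qed
  moreover have "card (earlier g H x) \<le> t \<and> clique_in H (earlier g H x)"
    if x: "x \<in> pverts H" for x
  proof (cases "x = v")
    case True
    have "earlier g H v = neighbours H v"
      using less by (auto simp: earlier_def neighbours_def dest: H.in_arcsD2 H.no_loops')
    then show ?thesis
      using True add_vertex.hyps by simp
  next
    case False
    have "earlier g H x = earlier f ?H x"
      using False less[OF x]
      by (auto simp: earlier_def neighbours_def remove_vertex_def g_def split: if_splits)
    moreover have "x \<in> pverts ?H"
      using x False by (simp add: remove_vertex_def)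
    moreover have "clique_in ?H S \<Longrightarrow> clique_in H S" for S
      unfolding clique_in_def remove_vertex_def by auto
    ultimately show ?thesis
      using f' by simp
  qed
  ultimately show ?case by blast
qed

lemma path_graph_position:
  assumes "path_graph P"
  shows "\<exists>pos :: 'b \<Rightarrow> nat. inj_on pos (pverts P) \<and>
    (\<forall>(p, q)\<in>parcs P. pos q = pos p + 1 \<or> pos p = pos q + 1)"
proof -
  obtain xs where xs: "distinct xs" "pverts P = set xs"
    "parcs P = (\<Union>i\<in>{i. Suc i < length xs}. {(xs ! i, xs ! Suc i), (xs ! Suc i, xs ! i)})"
    using assms by (auto simp: path_graph_def)
  define pos where "pos = the_inv_into {..<length xs} ((!) xs)"
  have inj: "inj_on ((!) xs) {..<length xs}"
    using xs(1) by (auto simp: inj_on_nth)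
  have pos: "pos (xs ! i) = i" if "i < length xs" for i
    using the_inv_into_f_f[OF inj] that by (simp add: pos_def)
  then have "inj_on pos (set xs)"
    by (auto simp: inj_on_def in_set_conv_nth)
  then show ?thesis
    using pos by (intro exI[of _ pos]) (auto simp: xs)
qed

section \<open>Counting forbidden colours in the strong product\<close>

theorem theorem4:
  fixes t l :: nat
    and H :: "'a pair_pre_digraph"
    and P :: "'b pair_pre_digraph"
    and K :: "'c pair_pre_digraph"
    and G :: "(('a \<times> 'b) \<times> 'c) pair_pre_digraph"
  assumes "l > 0"
    and "t_tree t H"
    and "path_graph P"
    and "complete_digraph l (with_proj K)"
    and "pair_graph G"
    and "subgraph (with_proj G) (with_proj (H \<boxtimes> P \<boxtimes> K))"
  shows "\<exists>\<phi>. odd_colouring G \<phi> \<and> num_colours G \<phi> \<le> 8 * l * t + 5 * l - 1"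
proof -
  interpret H: pair_graph H using assms(2) by (rule pair_graph_t_tree)
  interpret P: pair_graph P using assms(3) by (rule pair_graph_path_graph)
  interpret K: pair_graph K using assms(4) by (rule pair_graphI_complete)
  have cardK: "card (pverts K) = l"
    using assms(4) by (auto simp: complete_digraph_pair_def)
  obtain f :: "'a \<Rightarrow> nat" where f: "inj_on f (pverts H)"
    and earlier: "\<And>x. x \<in> pverts H \<Longrightarrow> card (earlier f H x) \<le> t"
      "\<And>x. x \<in> pverts H \<Longrightarrow> clique_in H (earlier f H x)"
    using t_tree_elimination_ordering[OF assms(2)] by blast
  obtain pos :: "'b \<Rightarrow> nat" where pos: "inj_on pos (pverts P)"
    and pos_arc: "\<And>p q. (p, q) \<in> parcs P \<Longrightarrow> pos q = pos p + 1 \<or> pos p = pos q + 1"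
    using path_graph_position[OF assms(3)] by auto
  obtain h :: "'c \<Rightarrow> nat" where h: "inj_on h (pverts K)"
    using finite_imp_inj_to_nat_seg[OF K.pair_finite_verts] by blast
  define r where "r = (\<lambda>((x, p), k). (f x, pos p, h k))"
  have verts: "pverts G \<subseteq> (pverts H \<times> pverts P) \<times> pverts K"
    using assms(6) by (auto simp: subgraph_def strong_product_def)
  have inj: "inj_on r (pverts G)"
    by (rule inj_on_subset[OF _ verts])
      (use f pos h in \<open>auto simp: r_def inj_on_def\<close>)
  have arcs: "parcs G \<subseteq> parcs (H \<boxtimes> P \<boxtimes> K)"
    using assms(6) by (auto simp: subgraph_def)
  have nbD: "x \<in> pverts H" "y \<in> pverts H" "q \<in> pverts P" "j \<in> pverts K"
      "y = x \<or> y \<in> neighbours H x" "x = y \<or> x \<in> neighbours H y"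
      "pos q \<le> pos p + 1" "pos p \<le> pos q + 1"
    if "((y, q), j) \<in> neighbours G ((x, p), k)" for x p k y q j
  proof -
    have arc: "(((x, p), k), ((y, q), j)) \<in> parcs (H \<boxtimes> P \<boxtimes> K)"
      using that arcs by (auto simp: neighbours_def)
    then show "x \<in> pverts H" "y \<in> pverts H" "q \<in> pverts P" "j \<in> pverts K"
      "y = x \<or> y \<in> neighbours H x" "x = y \<or> x \<in> neighbours H y"
      by (auto simp: strong_product_def neighbours_def dest: H.arcs_symmetric)
    have "p = q \<or> (p, q) \<in> parcs P"
      using arc by (auto simp: strong_product_def)
    then show "pos q \<le> pos p + 1" "pos p \<le> pos q + 1"
      using pos_arc by fastforce+
  qed
  have le_f: "y = x \<or> y \<in> earlier f H x"
    if "y = x \<or> y \<in> neighbours H x" "f y \<le> f x" "x \<in> pverts H" "y \<in> pverts H" for x y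
    using that f by (auto simp: earlier_def inj_on_def le_less)
  define I where "I i j = {q \<in> pverts P. i \<le> pos q \<and> pos q \<le> j}" for i j
  \<comment> \<open>Stating the bound additively keeps it applicable when a left end such as
    \<open>pos p - 2\<close> is truncated to 0.\<close>
  have card_I: "card (I i j) \<le> n" if "j + 1 \<le> i + n" for i j n
  proof -
    have "card (I i j) = card (pos ` I i j)"
      using pos by (intro card_image[symmetric]) (auto simp: I_def inj_on_def)
    also have "\<dots> \<le> card {i..j}"
      by (rule card_mono) (auto simp: I_def)
    finally show ?thesis using that by simp
  qed
  have fin: "finite (earlier f H x)" "finite (I i j)" for x i j
    by (auto simp: earlier_def neighbours_def I_def dest: H.in_arcsD2
      intro: finite_subset[OF _ H.pair_finite_verts])
  \<comment> \<open>Both counts have this shape. Over an earlier neighbour of \<open>x\<close>, all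
    \<open>d\<close> positions can occur; over \<open>x\<close> itself, the lexicographic order only
    leaves the \<open>e\<close> positions up to \<open>pos p\<close>, and the vertex itself is
    excluded.\<close>
  have card_box: "card S \<le> t * d * l + (e * l - 1)"
    if u: "((x, p), k) \<in> pverts G"
      and S: "S \<subseteq> (earlier f H x \<times> I i j) \<times> pverts K \<union> (({x} \<times> I i (pos p)) \<times> pverts K - {((x, p), k)})"
      and i: "i \<le> pos p" "j + 1 \<le> i + d" "pos p + 1 \<le> i + e"
    for S x p k i j d e
  proof -
    let ?A = "(earlier f H x \<times> I i j) \<times> pverts K"
    let ?B = "({x} \<times> I i (pos p)) \<times> pverts K"
    have mem: "((x, p), k) \<in> ?B" and x: "x \<in> pverts H"
      using u verts i by (auto simp: I_def)
    have "card S \<le> card (?A \<union> (?B - {((x, p), k)}))"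
      using S fin by (intro card_mono) auto
    also have "\<dots> \<le> card ?A + card (?B - {((x, p), k)})"
      by (rule card_Un_le)
    also have "card ?A \<le> t * d * l"
      using earlier(1)[OF x] card_I[OF i(2)] by (simp add: card_cartesian_product cardK mult_le_mono)
    also have "card (?B - {((x, p), k)}) \<le> e * l - 1"
      using mem card_I[OF i(3)] by (simp add: card_cartesian_product cardK diff_le_mono)
    finally show ?thesis by simp
  qed
  have "card {w \<in> neighbours G u. r w < r u} \<le> t * 3 * l + (2 * l - 1)" if "u \<in> pverts G" for u
  proof -
    obtain x p k where u: "u = ((x, p), k)" by (metis prod.exhaust)
    show ?thesis
    proof (rule card_box[of x p k _ "pos p - 1" "pos p + 1"])
      show "{w \<in> neighbours G u. r w < r u} \<subseteq>
        (earlier f H x \<times> I (pos p - 1) (pos p + 1)) \<times> pverts K \<union>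
        (({x} \<times> I (pos p - 1) (pos p)) \<times> pverts K - {((x, p), k)})" (is "?L \<subseteq> ?R")
      proof
        fix w assume "w \<in> ?L"
        moreover obtain y q j where w: "w = ((y, q), j)" by (metis prod.exhaust)
        ultimately have nb: "((y, q), j) \<in> neighbours G ((x, p), k)" and less: "r w < r u"
          by (auto simp: u)
        note nb = nbD[OF nb]
        have "f y \<le> f x"
          using less by (auto simp: r_def u w)
        then have "y = x \<or> y \<in> earlier f H x"
          using le_f[of y x] nb by auto
        then show "w \<in> ?R"
          using nb less by (auto simp: I_def r_def u w)
      qed
    qed (use that u in auto)
  qed
  moreover have "card {v. r v < r u \<and>
      (\<exists>w. u \<in> neighbours G w \<and> v \<in> neighbours G w \<and> r u < r w)} \<le> t * 5 * l + (3 * l - 1)"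
    if "u \<in> pverts G" for u
  proof -
    obtain x p k where u: "u = ((x, p), k)" by (metis prod.exhaust)
    show ?thesis
    \<comment> \<open>The path from \<open>u\<close> through \<open>w\<close> to \<open>v\<close>
      moves at most two positions, hence five positions over earlier vertices and three over
      \<open>x\<close>.\<close>
    proof (rule card_box[of x p k _ "pos p - 2" "pos p + 2"])
      show "{v. r v < r u \<and> (\<exists>w. u \<in> neighbours G w \<and> v \<in> neighbours G w \<and> r u < r w)} \<subseteq>
        (earlier f H x \<times> I (pos p - 2) (pos p + 2)) \<times> pverts K \<union>
        (({x} \<times> I (pos p - 2) (pos p)) \<times> pverts K - {((x, p), k)})" (is "?L \<subseteq> ?R")
      proof
        fix v assume "v \<in> ?L"
        moreover obtain z s i where v: "v = ((z, s), i)" by (metis prod.exhaust)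
        ultimately obtain y q j where
          nu: "((x, p), k) \<in> neighbours G ((y, q), j)" and
          nv: "((z, s), i) \<in> neighbours G ((y, q), j)" and
          less: "r v < r u" "r u < r ((y, q), j)"
          by (auto simp: u)
        note nu = nbD[OF nu] and nv = nbD[OF nv]
        have le: "f z \<le> f x" "f x \<le> f y"
          using less by (auto simp: r_def u v)
        \<comment> \<open>Since \<open>w\<close> comes last, \<open>x\<close> and \<open>z\<close>
          both lie in the clique formed by \<open>y\<close> and its earlier neighbours, so they are
          equal or adjacent.\<close>
        have "x = y \<or> x \<in> earlier f H y" "z = y \<or> z \<in> earlier f H y"
          using le_f[of x y] le_f[of z y] nu nv le by auto
        then have "z = x \<or> z \<in> neighbours H x"
          using earlier(2)[of y] nu le f
          by (auto simp: clique_in_def earlier_def neighbours_def)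
        then have "z = x \<or> z \<in> earlier f H x"
          using le_f[of z x] nu nv le by auto
        then show "v \<in> ?R"
          using nu nv less by (auto simp: I_def r_def u v)
      qed
    qed (use that u in auto)
  qed
  ultimately have "\<exists>\<phi>. odd_colouring G \<phi> \<and>
      num_colours G \<phi> \<le> (t * 3 * l + (2 * l - 1)) + (t * 5 * l + (3 * l - 1)) + 1"
    by (rule odd_colouring_by_ordering[OF assms(5) inj])
  \<comment> \<open>Here \<open>l > 0\<close> makes the truncated subtractions exact.\<close>
  also have "(t * 3 * l + (2 * l - 1)) + (t * 5 * l + (3 * l - 1)) + 1 = 8 * l * t + 5 * l - 1"
    using assms(1) by (simp add: algebra_simps)
  finally show ?thesis .
qed

end
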